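(* Let $k\in\mathbb{N}\setminus\{0\}$ and $p_1,\dots,p_k\in\mathbb{N}$. For all $x\in(0,1)$, as $N\to\infty$, $$\mathbb{E}\Big[D_N\big(\eta,\ p_1\delta_{\lfloor xN\rfloor+1}+\dots+p_k\delta_{\lfloor xN\rfloor+k}\big)\Big]=\rho_{\theta_L,\theta_R}(x)^{p_1+\dots+p_k}+O(N^{-1}).$$
   Context: $\mathbb{N}=\{0,1,2,\dots\}$. For $\theta\in[0,\infty)$, $\nu_\theta$ is the geometric distribution on $\mathbb{N}$ with mean $\theta$: $\nu_\theta(n)=\frac{1}{1+\theta}\big(\frac{\theta}{1+\theta}\big)^n$. Fix $0\le\theta_L<\theta_R$ and set $\rho_{\theta_L,\theta_R}(x)=\theta_L+(\theta_R-\theta_L)x$ for $x\in[0,1]$. For each $N\ge1$, let $\Theta=(\Theta_{1,N},\dots,\Theta_{N,N})$ be the order statistics (in non-decreasing order) of $N$ independent random variables uniformly distributed on $[\theta_L,\theta_R]$. The random configuration $\eta=(\eta_{1,N},\dots,\eta_{N,N})\in\mathbb{N}^N$ is such that, conditionally on $\Theta=(\theta_1,\dots,\theta_N)$, its law is the product measure $\otimes_{i=1}^N\nu_{\theta_i}$. The self-duality polynomials are, for $\eta,\xi\in\mathbb{N}^{\{1,\dots,N\}}$, $$D_N(\eta,\xi)=\prod_{i=1}^N\binom{\eta_{i,N}}{\xi_{i,N}}\mathbf{1}(\eta_{i,N}\ge\xi_{i,N}).$$ $\delta_i\in\mathbb{N}^{\{1,\dots,N\}}$ denotes the configuration with exactly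 one particle, at site $i$, so $p_1\delta_{\lfloor xN\rfloor+1}+\dots+p_k\delta_{\lfloor xN\rfloor+k}$ has $p_j$ particles at site $\lfloor xN\rfloor+j$ for each $j$ and none elsewhere ($N$ is taken large enough that $\lfloor xN\rfloor+k\le N$). The constant in $O(N^{-1})$ may depend on $x,k,p_1,\dots,p_k,\theta_L,\theta_R$. *)

theory Defs
  imports "HOL-Probability.Probability" "HOL-Library.Landau_Symbols"
begin

definition geom_mean :: "real \<Rightarrow> nat pmf" where
  "geom_mean \<theta> = geometric_pmf (1 / (1 + \<theta>))"

lemma pmf_geom_mean:
  assumes "0 \<le> \<theta>"
  shows "pmf (geom_mean \<theta>) n = 1 / (1 + \<theta>) * (\<theta> / (1 + \<theta>)) ^ n"
proof -
  have "1 - 1 / (1 + \<theta>) = \<theta> / (1 + \<theta>)"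
    using assms by (simp add: field_simps)
  then show ?thesis
    using assms by (simp add: geom_mean_def)
qed

definition linear_profile :: "real \<Rightarrow> real \<Rightarrow> real \<Rightarrow> real" where
  "linear_profile \<theta>L \<theta>R x = \<theta>L + (\<theta>R - \<theta>L) * x"

(* Sites and samples are indexed by 1, ..., N, list positions by 0, ..., N - 1. *)
definition order_statistic :: "nat \<Rightarrow> (nat \<Rightarrow> real) \<Rightarrow> nat \<Rightarrow> real" where
  "order_statistic N u i = sort (map u [1..<Suc N]) ! (i - 1)"

(* The law of X conditionally on T = t is \<kappa> t: for every event A, the conditional
   probability of X \<in> A given the sigma-algebra generated by T is \<kappa> T A. *)
definition has_conditional_law ::
  "'a measure \<Rightarrow> 'b measure \<Rightarrow> ('a \<Rightarrow> 'b) \<Rightarrow> 'c measure \<Rightarrow> ('a \<Rightarrow> 'c) \<Rightarrow> ('b \<Rightarrow> 'c measure) \<Rightarrow> bool"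
where
  "has_conditional_law M S T K X \<kappa> \<longleftrightarrow>
     T \<in> measurable M S \<and> X \<in> measurable M K \<and>
     (\<forall>A\<in>sets K. AE \<omega> in M.
        real_cond_exp M (vimage_algebra (space M) T S) (\<lambda>\<omega>. indicator A (X \<omega>)) \<omega>
          = measure (\<kappa> (T \<omega>)) A)"

(* A configuration on the sites 1, ..., N is a function on nat of which only the values at
   these sites are used. *)
definition duality_poly :: "nat \<Rightarrow> (nat \<Rightarrow> nat) \<Rightarrow> (nat \<Rightarrow> nat) \<Rightarrow> real" where
  "duality_poly N \<eta> \<xi> = (\<Prod>i = 1..N. real (\<eta> i choose \<xi> i) * of_bool (\<eta> i \<ge> \<xi> i))"

definition single_particle :: "nat \<Rightarrow> nat \<Rightarrow> nat" where
  "single_particle i = (\<lambda>j. if j = i then 1 else 0)"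

end

theory Submission
  imports Defs
begin

text \<open>
  The factorial moments of the geometric distribution are \<open>E[n choose p] = \<theta>\<^sup>p\<close>, so conditioning on
  \<open>\<Theta>\<close> turns the duality polynomial into \<open>\<Prod>\<^sub>j \<Theta>\<^bsub>m+j\<^esub>\<^bsup>p j\<^esup>\<close> with \<open>m = \<lfloor>x N\<rfloor>\<close>. The order statistics are
  nonnegative and increase with the index, hence this product lies between \<open>\<Theta>\<^bsub>m+1\<^esub>\<^bsup>P\<^esup>\<close> and
  \<open>\<Theta>\<^bsub>m+k\<^esub>\<^bsup>P\<^esup>\<close>, where \<open>P = \<Sum>\<^sub>j p j\<close>. For a single order statistic of \<open>N\<close> uniform variables on
  \<open>[0, 1]\<close>, the \<open>q\<close>-th moment is exactly \<open>r (r+1) \<dots> (r+q-1) / ((N+1) \<dots> (N+q))\<close>; with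
  \<open>r = \<lfloor>x N\<rfloor> + O(1)\<close> every factor is \<open>x + O(1/N)\<close>, and the binomial theorem transfers this to the
  interval \<open>[\<theta>L, \<theta>R]\<close>.
\<close>

section \<open>Integration against a conditional law\<close>

text \<open>\<open>has_conditional_law\<close> speaks of events only. Approximation by indicators,
  nonnegative combinations and increasing limits extends it to every nonnegative measurable
  \<open>f\<close>; staying with nonnegative integrals avoids any integrability condition.\<close>

lemma nn_integral_conditional_law:
  assumes "prob_space M" and law: "has_conditional_law M S T K X \<kappa>"
    and kernel: "\<And>t. t \<in> space S \<Longrightarrow> prob_space (\<kappa> t)" "\<And>t. t \<in> space S \<Longrightarrow> sets (\<kappa> t) = sets K"
    and f: "f \<in> borel_measurable K"
  shows "(\<integral>\<^sup>+\<omega>. f (X \<omega>) \<partial>M) = (\<integral>\<^sup>+\<omega>. (\<integral>\<^sup>+y. f y \<partial>\<kappa> (T \<omega>)) \<partial>M)"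
proof -
  interpret prob_space M by fact
  have T: "T \<in> measurable M S" and X[measurable]: "X \<in> measurable M K"
    using law by (auto simp: has_conditional_law_def)
  have TS: "T \<omega> \<in> space S" if "\<omega> \<in> space M" for \<omega>
    using T that by (rule measurable_space)
  have borel_\<kappa>: "u \<in> borel_measurable (\<kappa> (T \<omega>))" if "u \<in> borel_measurable K" "\<omega> \<in> space M"
    for \<omega> and u :: "_ \<Rightarrow> ennreal"
    using that measurable_cong_sets[OF kernel(2)[OF TS] refl] by auto
  let ?F = "vimage_algebra (space M) T S"
  interpret finite_measure_subalgebra M ?F
  proof
    show "subalgebra M ?F"
      using T by (auto simp: subalgebra_def sets_vimage_algebra2 measurable_space intro: measurable_sets)
  qed
  \<comment> \<open>The inner integral need not be measurable in \<open>\<omega>\<close> since \<open>\<kappa>\<close> is not assumed to be; it only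
    agrees almost everywhere with a measurable function, which the induction carries along.\<close>
  have "\<exists>g\<in>borel_measurable M. (AE \<omega> in M. g \<omega> = (\<integral>\<^sup>+y. f y \<partial>\<kappa> (T \<omega>))) \<and>
      (\<integral>\<^sup>+\<omega>. f (X \<omega>) \<partial>M) = (\<integral>\<^sup>+\<omega>. g \<omega> \<partial>M)"
    using f
  proof (induction rule: borel_measurable_induct)
    case (cong f g)
    have "(\<integral>\<^sup>+y. f y \<partial>\<kappa> (T \<omega>)) = (\<integral>\<^sup>+y. g y \<partial>\<kappa> (T \<omega>))" if "\<omega> \<in> space M" for \<omega>
      using cong(3) sets_eq_imp_space_eq[OF kernel(2)[OF TS[OF that]]]
      by (intro nn_integral_cong) simp
    then have "(AE \<omega> in M. h \<omega> = (\<integral>\<^sup>+y. f y \<partial>\<kappa> (T \<omega>))) = (AE \<omega> in M. h \<omega> = (\<integral>\<^sup>+y. g y \<partial>\<kappa> (T \<omega>)))" for h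
      by (intro AE_cong) simp
    moreover have "(\<integral>\<^sup>+\<omega>. f (X \<omega>) \<partial>M) = (\<integral>\<^sup>+\<omega>. g (X \<omega>) \<partial>M)"
      using cong(3) measurable_space[OF X] by (intro nn_integral_cong) simp
    ultimately show ?case using cong(4) by simp
  next
    case (set A)
    let ?c = "real_cond_exp M ?F (\<lambda>\<omega>. indicator A (X \<omega>))"
    have int: "integrable M (\<lambda>\<omega>. indicator A (X \<omega>) :: real)"
      using set by (intro integrable_const_bound[where B = 1]) auto
    have c: "AE \<omega> in M. ?c \<omega> = measure (\<kappa> (T \<omega>)) A"
      using law set by (auto simp: has_conditional_law_def)
    have "(\<integral>\<^sup>+\<omega>. indicator A (X \<omega>) \<partial>M) = (\<integral>\<^sup>+\<omega>. ennreal (indicator A (X \<omega>)) \<partial>M)"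
      by (intro nn_integral_cong) (auto simp: indicator_def)
    also have "\<dots> = ennreal (\<integral>\<omega>. indicator A (X \<omega>) \<partial>M)"
      by (intro nn_integral_eq_integral int) auto
    also have "\<dots> = ennreal (\<integral>\<omega>. ?c \<omega> \<partial>M)"
      using real_cond_exp_int(2)[OF int] by simp
    \<comment> \<open>\<open>?c\<close> is known to be nonnegative only almost everywhere, because
      there it equals a probability.\<close>
    also have "\<dots> = (\<integral>\<^sup>+\<omega>. ennreal (?c \<omega>) \<partial>M)"
      using c by (intro nn_integral_eq_integral[symmetric] real_cond_exp_int(1)[OF int]) auto
    finally have "(\<integral>\<^sup>+\<omega>. indicator A (X \<omega>) \<partial>M) = (\<integral>\<^sup>+\<omega>. ennreal (?c \<omega>) \<partial>M)" .
    moreover have "AE \<omega> in M. ennreal (?c \<omega>) = (\<integral>\<^sup>+y. indicator A y \<partial>\<kappa> (T \<omega>))"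
      using c AE_space
    proof eventually_elim
      case (elim \<omega>)
      interpret \<kappa>: prob_space "\<kappa> (T \<omega>)" using elim TS kernel(1) by blast
      show ?case using elim set kernel(2)[OF TS] by (simp add: \<kappa>.emeasure_eq_measure)
    qed
    ultimately show ?case
      by (intro bexI[of _ "\<lambda>\<omega>. ennreal (?c \<omega>)"]) auto
  next
    case (mult u c)
    then obtain g where g[measurable]: "g \<in> borel_measurable M"
      and "AE \<omega> in M. g \<omega> = (\<integral>\<^sup>+y. u y \<partial>\<kappa> (T \<omega>))"
      and eq: "(\<integral>\<^sup>+\<omega>. u (X \<omega>) \<partial>M) = (\<integral>\<^sup>+\<omega>. g \<omega> \<partial>M)" by blast
    have "AE \<omega> in M. c * g \<omega> = (\<integral>\<^sup>+y. c * u y \<partial>\<kappa> (T \<omega>))"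
      using \<open>AE \<omega> in M. g \<omega> = _\<close> AE_space
    proof eventually_elim
      case (elim \<omega>)
      then show ?case using borel_\<kappa>[OF mult(2)] by (simp add: nn_integral_cmult)
    qed
    moreover have "(\<integral>\<^sup>+\<omega>. c * u (X \<omega>) \<partial>M) = (\<integral>\<^sup>+\<omega>. c * g \<omega> \<partial>M)"
      using mult(2) by (simp add: nn_integral_cmult eq)
    ultimately show ?case by (intro bexI[of _ "\<lambda>\<omega>. c * g \<omega>"]) auto
  next
    case (add u v)
    obtain g where g[measurable]: "g \<in> borel_measurable M"
      and gu: "AE \<omega> in M. g \<omega> = (\<integral>\<^sup>+y. u y \<partial>\<kappa> (T \<omega>))"
      and eqg: "(\<integral>\<^sup>+\<omega>. u (X \<omega>) \<partial>M) = (\<integral>\<^sup>+\<omega>. g \<omega> \<partial>M)" using add.IH(1) by blast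
    obtain h where h[measurable]: "h \<in> borel_measurable M"
      and hv: "AE \<omega> in M. h \<omega> = (\<integral>\<^sup>+y. v y \<partial>\<kappa> (T \<omega>))"
      and eqh: "(\<integral>\<^sup>+\<omega>. v (X \<omega>) \<partial>M) = (\<integral>\<^sup>+\<omega>. h \<omega> \<partial>M)" using add.IH(2) by blast
    have "AE \<omega> in M. h \<omega> + g \<omega> = (\<integral>\<^sup>+y. v y + u y \<partial>\<kappa> (T \<omega>))"
      using gu hv AE_space
    proof eventually_elim
      case (elim \<omega>)
      then show ?case using borel_\<kappa>[OF add.hyps(1)] borel_\<kappa>[OF add.hyps(3)]
        by (simp add: nn_integral_add)
    qed
    moreover have "(\<integral>\<^sup>+\<omega>. v (X \<omega>) + u (X \<omega>) \<partial>M) = (\<integral>\<^sup>+\<omega>. h \<omega> + g \<omega> \<partial>M)"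
      using add.hyps by (simp add: nn_integral_add eqg eqh)
    ultimately show ?case by (intro bexI[of _ "\<lambda>\<omega>. h \<omega> + g \<omega>"]) auto
  next
    case (seq V)
    from seq.IH obtain g where g[measurable]: "\<And>i. g i \<in> borel_measurable M"
      and gV: "\<And>i. AE \<omega> in M. g i \<omega> = (\<integral>\<^sup>+y. V i y \<partial>\<kappa> (T \<omega>))"
      and eq: "\<And>i. (\<integral>\<^sup>+\<omega>. V i (X \<omega>) \<partial>M) = (\<integral>\<^sup>+\<omega>. g i \<omega> \<partial>M)" by metis
    \<comment> \<open>The exceptional null set depends on \<open>i\<close>. Merging countably many
      of them gives one set of full measure that serves all \<open>i\<close> at once.\<close>
    have gV': "AE \<omega> in M. \<forall>i. g i \<omega> = (\<integral>\<^sup>+y. V i y \<partial>\<kappa> (T \<omega>))"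
      using gV by (simp add: AE_all_countable)
    have "AE \<omega> in M. (SUP i. g i \<omega>) = (\<integral>\<^sup>+y. (SUP i. V i) y \<partial>\<kappa> (T \<omega>))"
      using gV' AE_space
    proof eventually_elim
      case (elim \<omega>)
      then show ?case using borel_\<kappa>[OF seq.hyps(1)]
        by (simp add: nn_integral_monotone_convergence_SUP[OF seq.hyps(3)] image_comp)
    qed
    moreover have "(\<integral>\<^sup>+\<omega>. (SUP i. V i) (X \<omega>) \<partial>M) = (\<integral>\<^sup>+\<omega>. (SUP i. g i \<omega>) \<partial>M)"
    proof -
      have "(\<integral>\<^sup>+\<omega>. (SUP i. V i) (X \<omega>) \<partial>M) = (SUP i. \<integral>\<^sup>+\<omega>. V i (X \<omega>) \<partial>M)"
        unfolding SUP_apply using seq.hyps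
        by (intro nn_integral_monotone_convergence_SUP) (auto simp: incseq_def le_fun_def)
      also have "\<dots> = (SUP i. \<integral>\<^sup>+\<omega>. g i \<omega> \<partial>M)" by (simp add: eq)
      \<comment> \<open>The functions \<open>g i\<close> are known to increase in \<open>i\<close>
        only off that null set, hence the almost-everywhere form of monotone convergence.\<close>
      also have "\<dots> = (\<integral>\<^sup>+\<omega>. (SUP i. g i \<omega>) \<partial>M)"
      proof (intro nn_integral_monotone_convergence_SUP_AE[symmetric] g)
        show "AE \<omega> in M. g i \<omega> \<le> g (Suc i) \<omega>" for i
          using gV' by eventually_elim
            (simp add: nn_integral_mono le_funD[OF incseq_SucD[OF seq.hyps(3)]])
      qed
      finally show ?thesis .
    qed
    ultimately show ?case by (intro bexI[of _ "\<lambda>\<omega>. SUP i. g i \<omega>"]) auto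
  qed
  then obtain g where "AE \<omega> in M. g \<omega> = (\<integral>\<^sup>+y. f y \<partial>\<kappa> (T \<omega>))"
    and "(\<integral>\<^sup>+\<omega>. f (X \<omega>) \<partial>M) = (\<integral>\<^sup>+\<omega>. g \<omega> \<partial>M)" by blast
  then show ?thesis using nn_integral_cong_AE[of g] by simp
qed

section \<open>Factorial moments of the geometric distribution\<close>

text \<open>Terms with \<open>n < m\<close> vanish. After the shift \<open>n = j + m\<close> the
  remaining weights are \<open>\<theta> ^ m\<close> times the negative binomial weights with
  parameters \<open>m + 1\<close> and \<open>q\<close>, which sum to 1; the identity
  \<open>1 - q = \<theta> * q\<close> produces the power of \<theta>.\<close>

lemma nn_integral_binomial_geom_mean:
  assumes "0 \<le> \<theta>"
  shows "(\<integral>\<^sup>+n. ennreal (real (n choose m)) \<partial>measure_pmf (geom_mean \<theta>)) = ennreal (\<theta> ^ m)"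
proof -
  define q where "q = 1 / (1 + \<theta>)"
  have q: "0 < q" "q \<le> 1" "1 - q = \<theta> * q"
    using assms by (auto simp: q_def field_simps)
  let ?f = "\<lambda>n. ennreal (pmf (geom_mean \<theta>) n) * ennreal (real (n choose m))"
  have "(\<integral>\<^sup>+n. ennreal (real (n choose m)) \<partial>measure_pmf (geom_mean \<theta>)) = (\<integral>\<^sup>+n. ?f n \<partial>count_space UNIV)"
    by (simp add: nn_integral_measure_pmf)
  also have "\<dots> = (\<integral>\<^sup>+n. ?f n \<partial>count_space {m..})"
    by (intro nn_integral_count_space_eq) (auto simp: binomial_eq_0 not_le)
  also have "\<dots> = (\<integral>\<^sup>+j. ?f (j + m) \<partial>count_space UNIV)"
    by (intro nn_integral_bij_count_space[symmetric] bij_betwI[where g = "\<lambda>n. n - m"]) auto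
  also have "\<dots> = (\<integral>\<^sup>+j. ennreal (\<theta> ^ m) * ennreal (pmf (neg_binomial_pmf (Suc m) q) j) \<partial>count_space UNIV)"
  proof (intro nn_integral_cong)
    fix j
    have "j + m choose m = (j + m choose j)"
      by (subst binomial_symmetric) auto
    moreover have "pmf (geom_mean \<theta>) (j + m) = q * (1 - q) ^ (j + m)"
      using q by (simp add: geom_mean_def flip: q_def)
    moreover have "(1 - q) ^ (j + m) = \<theta> ^ m * q ^ m * (1 - q) ^ j"
      using q(3) by (simp add: power_add power_mult_distrib)
    ultimately show "?f (j + m) = ennreal (\<theta> ^ m) * ennreal (pmf (neg_binomial_pmf (Suc m) q) j)"
      using q assms by (subst pmf_neg_binomial) (auto simp flip: ennreal_mult intro!: arg_cong[of _ _ ennreal])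
  qed
  also have "\<dots> = ennreal (\<theta> ^ m)"
    by (simp add: nn_integral_cmult nn_integral_pmf)
  finally show ?thesis .
qed

section \<open>Order statistics of a fixed sample\<close>

lemma order_statistic_mono:
  assumes "1 \<le> i" "i \<le> j" "j \<le> N"
  shows "order_statistic N u i \<le> order_statistic N u j"
  unfolding order_statistic_def using assms by (intro sorted_nth_mono) auto

lemma order_statistic_in:
  assumes "1 \<le> i" "i \<le> N"
  shows "order_statistic N u i \<in> u ` {1..N}"
proof -
  have "order_statistic N u i \<in> set (sort (map u [1..<Suc N]))"
    unfolding order_statistic_def using assms by (intro nth_mem) auto
  then show ?thesis by auto
qed

text \<open>In a sorted list the entries below \<open>t\<close> occupy an initial segment of the
  positions. Position \<open>i\<close> lies outside it exactly when the segment has at most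
  \<open>i\<close> elements.\<close>

lemma sorted_le_nth_iff:
  fixes xs :: "'a :: linorder list"
  assumes "sorted xs" "i < length xs"
  shows "t \<le> xs ! i \<longleftrightarrow> length (filter (\<lambda>y. y < t) xs) \<le> i"
proof -
  let ?A = "{j. j < length xs \<and> xs ! j < t}"
  have len: "length (filter (\<lambda>y. y < t) xs) = card ?A"
    by (simp add: length_filter_conv_card)
  show ?thesis
  proof
    assume "t \<le> xs ! i"
    then have "?A \<subseteq> {..<i}"
      using assms by (force simp: not_less dest: sorted_nth_mono)
    then show "length (filter (\<lambda>y. y < t) xs) \<le> i"
      using card_mono[of "{..<i}" ?A] len by simp
  next
    assume "length (filter (\<lambda>y. y < t) xs) \<le> i"
    then have "\<not> {..i} \<subseteq> ?A"
      using card_mono[of ?A "{..i}"] len by auto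
    then obtain j where "j \<le> i" "t \<le> xs ! j" using assms(2) by (force simp: not_less)
    then show "t \<le> xs ! i" using assms sorted_nth_mono[of xs j i] by auto
  qed
qed

text \<open>This trades sorting for counting: sorting does not change how many samples lie below
  \<open>t\<close>. Since \<open>i\<close> counts from 1, the list bound "at most
  \<open>i - 1\<close>" reads \<open>< i\<close>.\<close>

lemma le_order_statistic_iff:
  assumes "1 \<le> i" "i \<le> N"
  shows "t \<le> order_statistic N u i \<longleftrightarrow> card {j \<in> {1..N}. u j < t} < i"
proof -
  let ?xs = "map u [1..<Suc N]"
  have "length (filter (\<lambda>y. y < t) (sort ?xs)) = length (filter (\<lambda>y. y < t) ?xs)"
    by (simp only: filter_sort length_sort)
  also have "\<dots> = card (set (filter (\<lambda>j. u j < t) [1..<Suc N]))"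
    by (subst distinct_card) (auto simp: filter_map o_def)
  also have "set (filter (\<lambda>j. u j < t) [1..<Suc N]) = {j \<in> {1..N}. u j < t}"
    by auto
  finally have "length (filter (\<lambda>y. y < t) (sort ?xs)) = card {j \<in> {1..N}. u j < t}" .
  then show ?thesis
    unfolding order_statistic_def using assms
    by (subst sorted_le_nth_iff) auto
qed

section \<open>Binomial counts and Beta sums\<close>

text \<open>The event is split according to the exact set \<open>S\<close> of indices whose variable
  lies below \<open>t\<close>. These events are disjoint, independence gives each the same
  probability, and there are \<open>card I choose s\<close> of them.\<close>

lemma (in prob_space) prob_card_eq_binomial:
  assumes ind: "indep_vars (\<lambda>_. borel) U I" and I: "finite I"
    and p: "\<And>i. i \<in> I \<Longrightarrow> prob {\<omega> \<in> space M. U i \<omega> < (t :: real)} = p"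
  shows "prob {\<omega> \<in> space M. card {i \<in> I. U i \<omega> < t} = s} = real (card I choose s) * p ^ s * (1 - p) ^ (card I - s)"
\<comment> \<open>The empty index set is treated apart because an intersection over it would be
  \<open>UNIV\<close> rather than \<open>space M\<close>.\<close>
proof (cases "I = {}")
  case True
  then show ?thesis by (cases "s = 0") (auto simp: prob_space)
next
  case False
  have rv[measurable]: "U i \<in> borel_measurable M" if "i \<in> I" for i
    using ind that by (simp add: indep_vars_def)
  define E where "E S = {\<omega> \<in> space M. {i \<in> I. U i \<omega> < t} = S}" for S
  have E_eq: "E S = (\<Inter>i\<in>I. U i -` (if i \<in> S then {..<t} else {t..}) \<inter> space M)" if "S \<subseteq> I" for S
    using that False by (force simp: E_def split: if_splits)
  have E_events: "E S \<in> events" if "S \<subseteq> I" for S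
    unfolding E_eq[OF that] using False I by (intro sets.finite_INT) auto
  have prob_E: "prob (E S) = p ^ card S * (1 - p) ^ (card I - card S)" if S: "S \<subseteq> I" for S
  proof -
    have *: "prob (U i -` (if i \<in> S then {..<t} else {t..}) \<inter> space M) = (if i \<in> S then p else 1 - p)"
      if "i \<in> I" for i
    proof -
      have "U i -` {..<t} \<inter> space M = {\<omega> \<in> space M. U i \<omega> < t}" by auto
      moreover have "U i -` {t..} \<inter> space M = space M - {\<omega> \<in> space M. U i \<omega> < t}" by auto
      ultimately show ?thesis using p[OF that] rv[OF that] by (simp add: prob_compl)
    qed
    have "prob (E S) = (\<Prod>i\<in>I. if i \<in> S then p else 1 - p)"
      unfolding E_eq[OF S] using False I
      by (subst indep_varsD_finite[OF ind]) (auto simp: *)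
    also have "\<dots> = p ^ card S * (1 - p) ^ card (I - S)"
      using I S by (simp add: prod.If_cases Int_absorb1 Diff_eq)
    finally show ?thesis using I S by (simp add: card_Diff_subset finite_subset)
  qed
  have "{\<omega> \<in> space M. card {i \<in> I. U i \<omega> < t} = s} = (\<Union>S\<in>{S. S \<subseteq> I \<and> card S = s}. E S)"
    by (auto simp: E_def)
  then have "prob {\<omega> \<in> space M. card {i \<in> I. U i \<omega> < t} = s} = prob (\<Union>S\<in>{S. S \<subseteq> I \<and> card S = s}. E S)"
    by simp
  also have "\<dots> = (\<Sum>S | S \<subseteq> I \<and> card S = s. prob (E S))"
    using I E_events by (intro finite_measure_finite_Union) (auto simp: disjoint_family_on_def E_def)
  also have "\<dots> = (\<Sum>S | S \<subseteq> I \<and> card S = s. p ^ s * (1 - p) ^ (card I - s))"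
    by (intro sum.cong) (auto simp: prob_E)
  also have "\<dots> = real (card I choose s) * p ^ s * (1 - p) ^ (card I - s)"
    using I by (simp add: n_subsets)
  finally show ?thesis .
qed

lemma nn_integral_Beta_nat:
  "(\<integral>\<^sup>+t. ennreal (t ^ m * (1 - t) ^ n) * indicator {0..1} t \<partial>lborel)
     = ennreal (fact m * fact n / fact (m + n + 1))"
proof -
  have "Beta (real m + 1) (real n + 1) = fact m * fact n / fact (m + n + 1)"
    using Gamma_fact[of m, where 'a = real] Gamma_fact[of n, where 'a = real]
      Gamma_fact[of "m + n + 1", where 'a = real]
    by (simp add: Beta_def algebra_simps)
  then have "((\<lambda>t. t powr real m * (1 - t) powr real n) has_integral fact m * fact n / fact (m + n + 1)) {0..1}"
    using has_integral_Beta_real[of "real m + 1" "real n + 1"] by simp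
  \<comment> \<open>The two integrands can differ only at the endpoints: \<open>0 powr 0\<close> is
    0 whereas \<open>0 ^ 0\<close> is 1.\<close>
  then have "((\<lambda>t. t ^ m * (1 - t) ^ n) has_integral fact m * fact n / fact (m + n + 1)) {0..1::real}"
    by (rule has_integral_spike[where S = "{0, 1}", rotated 2]) (auto simp: powr_realpow)
  then show ?thesis
    by (rule nn_integral_has_integral_lebesgue'[rotated]) auto
qed

text \<open>The hockey-stick identity for rising factorials. The sum telescopes, since
  \<open>pochhammer (r + 1) (q + 1) - pochhammer r (q + 1) = (q + 1) * pochhammer (r + 1) q\<close>,
  which is the summand at \<open>s = r\<close>.\<close>

lemma sum_fact_ratio_eq_pochhammer:
  "(\<Sum>s<r. real (Suc q) * fact (s + q) / fact s) = pochhammer (real r) (Suc q)"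
proof (induction r)
  case (Suc r)
  have "fact (r + q) = fact r * pochhammer (real r + 1) q"
    using pochhammer_product'[of "1::real" r q] by (simp add: pochhammer_fact add.commute)
  moreover have "pochhammer (real r) (Suc q) = real r * pochhammer (real r + 1) q"
    by (rule pochhammer_rec)
  moreover have "pochhammer (real (Suc r)) (Suc q) = pochhammer (real r + 1) q * (real r + 1 + real q)"
    by (simp add: pochhammer_Suc add.commute)
  ultimately show ?case using Suc by (simp add: algebra_simps add_divide_distrib)
qed (simp add: pochhammer_0_left)

text \<open>The binomial coefficient cancels \<open>fact (N - s)\<close> and leaves the summand of
  the hockey-stick identity. The bound on \<open>r\<close> ensures \<open>s \<le> N\<close>
  throughout.\<close>

lemma sum_binomial_beta:
  assumes "r \<le> Suc N"
  shows "(\<Sum>s<r. real (Suc q) * real (N choose s) * (fact (s + q) * fact (N - s) / fact (N + q + 1)))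
    = pochhammer (real r) (Suc q) / pochhammer (real N + 1) (Suc q)"
proof -
  have "fact (N + q + 1) = fact N * pochhammer (real N + 1) (Suc q)"
    using pochhammer_product'[of "1::real" N "Suc q"] by (simp add: pochhammer_fact add.commute)
  then have "real (Suc q) * real (N choose s) * (fact (s + q) * fact (N - s) / fact (N + q + 1))
      = real (Suc q) * fact (s + q) / fact s / pochhammer (real N + 1) (Suc q)" if "s < r" for s
    using that assms by (simp add: binomial_fact field_simps del: of_nat_Suc)
  then have "(\<Sum>s<r. real (Suc q) * real (N choose s) * (fact (s + q) * fact (N - s) / fact (N + q + 1)))
      = (\<Sum>s<r. real (Suc q) * fact (s + q) / fact s / pochhammer (real N + 1) (Suc q))"
    by (intro sum.cong) auto
  also have "\<dots> = pochhammer (real r) (Suc q) / pochhammer (real N + 1) (Suc q)"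
    by (simp only: sum_fact_ratio_eq_pochhammer flip: sum_divide_distrib)
  finally show ?thesis .
qed

section \<open>Moments of uniform order statistics\<close>

locale uniform_sample = prob_space +
  fixes U :: "nat \<Rightarrow> 'a \<Rightarrow> real" and N :: nat and a b :: real
  assumes a_less_b: "a < b"
    and indep: "indep_vars (\<lambda>_. borel) U {1..N}"
    and uniform: "\<And>i. i \<in> {1..N} \<Longrightarrow> distr M borel (U i) = uniform_measure lborel {a..b}"
begin

definition ordered :: "nat \<Rightarrow> 'a \<Rightarrow> real" where
  "ordered i \<omega> = order_statistic N (\<lambda>j. U j \<omega>) i"

text \<open>For \<open>i\<close> in \<open>{1..N}\<close> this is the \<open>i\<close>-th order
  statistic of a uniform sample on the unit interval, a Beta variable with parameters
  \<open>i\<close> and \<open>N + 1 - i\<close>, whose moments are explicit.\<close>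

definition rescaled :: "nat \<Rightarrow> 'a \<Rightarrow> real" where
  "rescaled i \<omega> = (ordered i \<omega> - a) / (b - a)"

lemma U_measurable [measurable]: "i \<in> {1..N} \<Longrightarrow> U i \<in> borel_measurable M"
  using indep by (simp add: indep_vars_def)

lemma prob_less:
  assumes i: "i \<in> {1..N}" and t: "0 \<le> t" "t \<le> 1"
  shows "prob {\<omega> \<in> space M. U i \<omega> < a + (b - a) * t} = t"
proof -
  have "prob {\<omega> \<in> space M. U i \<omega> < a + (b - a) * t} = measure (distr M borel (U i)) {..<a + (b - a) * t}"
    using i by (subst measure_distr) (auto intro!: arg_cong[of _ _ prob])
  also have "\<dots> = measure lborel ({a..b} \<inter> {..<a + (b - a) * t}) / (b - a)"
    using a_less_b by (simp add: uniform[OF i])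
  also have "{a..b} \<inter> {..<a + (b - a) * t} = {a..<a + (b - a) * t}"
  proof -
    have "(b - a) * t \<le> b - a" using t a_less_b by (simp add: mult_left_le)
    then show ?thesis by auto
  qed
  finally show ?thesis using a_less_b t by simp
qed

lemma AE_U_in: "AE \<omega> in M. \<forall>i\<in>{1..N}. U i \<omega> \<in> {a..b}"
proof (intro AE_finite_allI)
  fix i assume i: "i \<in> {1..N}"
  have "AE x in distr M borel (U i). x \<in> {a..b}"
    unfolding uniform[OF i] by (intro AE_uniform_measureI) auto
  then show "AE \<omega> in M. U i \<omega> \<in> {a..b}"
    using i by (simp add: AE_distr_iff)
qed simp

lemma AE_ordered_in: "AE \<omega> in M. \<forall>i\<in>{1..N}. ordered i \<omega> \<in> {a..b}"
  using AE_U_in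
proof eventually_elim
  case (elim \<omega>)
  then show ?case
    using order_statistic_in[of _ N "\<lambda>j. U j \<omega>"] unfolding ordered_def by fastforce
qed

lemma le_rescaled_iff:
  assumes "i \<in> {1..N}"
  shows "t \<le> rescaled i \<omega> \<longleftrightarrow> card {j \<in> {1..N}. U j \<omega> < a + (b - a) * t} < i"
proof -
  have "t \<le> rescaled i \<omega> \<longleftrightarrow> a + (b - a) * t \<le> ordered i \<omega>"
    using a_less_b by (simp add: rescaled_def field_simps)
  also have "\<dots> \<longleftrightarrow> card {j \<in> {1..N}. U j \<omega> < a + (b - a) * t} < i"
    using assms unfolding ordered_def by (intro le_order_statistic_iff) auto
  finally show ?thesis .
qed

lemma card_measurable: "(\<lambda>\<omega>. card {j \<in> {1..N}. U j \<omega> < t}) \<in> measurable M (count_space UNIV)"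
proof -
  have "card {j \<in> {1..N}. U j \<omega> < t} = (\<Sum>j\<in>{1..N}. if U j \<omega> < t then 1 else 0)" for \<omega>
    by (simp add: sum.If_cases Int_def)
  then show ?thesis by simp
qed

text \<open>Superlevel sets are events about the number of samples below a threshold, so nothing
  about the measurability of sorting has to be shown.\<close>

lemma rescaled_measurable [measurable]:
  assumes "i \<in> {1..N}"
  shows "rescaled i \<in> borel_measurable M"
proof (rule borel_measurableI_ge)
  fix t
  show "{\<omega> \<in> space M. t \<le> rescaled i \<omega>} \<in> events"
    unfolding le_rescaled_iff[OF assms] using card_measurable by measurable
qed

text \<open>The \<open>i\<close>-th smallest value reaches \<open>t\<close> exactly when fewer than
  \<open>i\<close> samples fall below it, and that number is binomial with success probability
  \<open>t\<close>.\<close>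

lemma prob_le_rescaled:
  assumes i: "i \<in> {1..N}" and t: "0 \<le> t" "t \<le> 1"
  shows "prob {\<omega> \<in> space M. t \<le> rescaled i \<omega>} = (\<Sum>s<i. real (N choose s) * t ^ s * (1 - t) ^ (N - s))"
proof -
  note card_measurable[measurable]
  let ?C = "\<lambda>\<omega>. card {j \<in> {1..N}. U j \<omega> < a + (b - a) * t}"
  have "{\<omega> \<in> space M. t \<le> rescaled i \<omega>} = (\<Union>s<i. {\<omega> \<in> space M. ?C \<omega> = s})"
    unfolding le_rescaled_iff[OF i] by auto
  then have "prob {\<omega> \<in> space M. t \<le> rescaled i \<omega>} = prob (\<Union>s<i. {\<omega> \<in> space M. ?C \<omega> = s})"
    by simp
  also have "\<dots> = (\<Sum>s<i. prob {\<omega> \<in> space M. ?C \<omega> = s})"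
    by (intro finite_measure_finite_Union) (auto simp: disjoint_family_on_def)
  also have "\<dots> = (\<Sum>s<i. real (N choose s) * t ^ s * (1 - t) ^ (N - s))"
    using prob_card_eq_binomial[OF indep _ prob_less[OF _ t]] by simp
  finally show ?thesis .
qed

lemma AE_rescaled_in: "i \<in> {1..N} \<Longrightarrow> AE \<omega> in M. rescaled i \<omega> \<in> {0..1}"
  using AE_ordered_in by eventually_elim (use a_less_b in \<open>auto simp: rescaled_def field_simps\<close>)

lemma integrable_rescaled_power:
  assumes "i \<in> {1..N}"
  shows "integrable M (\<lambda>\<omega>. rescaled i \<omega> ^ q)"
proof (rule integrable_const_bound[where B = 1])
  show "AE \<omega> in M. norm (rescaled i \<omega> ^ q) \<le> 1"
    using AE_rescaled_in[OF assms] by eventually_elim (simp add: power_le_one)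
qed (use assms in simp)

text \<open>Layer cake: \<open>V ^ (q + 1)\<close> is the integral of \<open>(q + 1) t ^ q\<close> over \<open>t \<le> V\<close>. After exchanging
  the integrals, every term of the binomial tail becomes a Beta integral.\<close>

lemma nn_integral_rescaled_power:
  assumes i: "i \<in> {1..N}"
  shows "(\<integral>\<^sup>+\<omega>. ennreal (rescaled i \<omega> ^ Suc q) \<partial>M)
    = ennreal (pochhammer (real i) (Suc q) / pochhammer (real N + 1) (Suc q))"
proof -
  interpret pair_sigma_finite M lborel ..
  let ?g = "\<lambda>\<omega> t. ennreal (real (Suc q) * t ^ q) * indicator {0..1} t * indicator {t. t \<le> rescaled i \<omega>} t"
  have [measurable]: "case_prod ?g \<in> borel_measurable (M \<Otimes>\<^sub>M lborel)"
    using i unfolding indicator_def by measurable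
  have layer: "AE \<omega> in M. ennreal (rescaled i \<omega> ^ Suc q) = (\<integral>\<^sup>+t. ?g \<omega> t \<partial>lborel)"
    using AE_rescaled_in[OF i]
  proof eventually_elim
    case (elim \<omega>)
    have "(\<integral>\<^sup>+t. ?g \<omega> t \<partial>lborel)
        = (\<integral>\<^sup>+t. ennreal (real (Suc q) * t ^ q) * indicator {0..rescaled i \<omega>} t \<partial>lborel)"
      using elim by (intro nn_integral_cong) (auto simp: indicator_def)
    also have "\<dots> = ennreal (rescaled i \<omega> ^ Suc q - 0 ^ Suc q)"
      using elim by (intro nn_integral_FTC_Icc[where F = "\<lambda>t. t ^ Suc q"])
        (auto intro!: derivative_eq_intros simp del: power_Suc of_nat_Suc)
    finally show ?case by simp
  qed
  \<comment> \<open>The identity holds for every real \<open>t\<close>, since both sides vanish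
    outside the unit interval. Inside it, the tail probability of \<open>rescaled i\<close> is
    expanded into binomial terms.\<close>
  have prob: "(\<integral>\<^sup>+\<omega>. ?g \<omega> t \<partial>M) = (\<Sum>s<i. ennreal (real (Suc q) * real (N choose s)) *
      (ennreal (t ^ (s + q) * (1 - t) ^ (N - s)) * indicator {0..1} t))" for t
  proof (cases "t \<in> {0..1}")
    case True
    have "(\<integral>\<^sup>+\<omega>. ?g \<omega> t \<partial>M)
        = ennreal (real (Suc q) * t ^ q) * (\<integral>\<^sup>+\<omega>. indicator {\<omega> \<in> space M. t \<le> rescaled i \<omega>} \<omega> \<partial>M)"
      using True i by (subst nn_integral_cmult[symmetric])
        (auto intro!: nn_integral_cong simp: indicator_def)
    also have "\<dots> = ennreal (real (Suc q) * t ^ q * prob {\<omega> \<in> space M. t \<le> rescaled i \<omega>})"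
      using True i by (simp add: emeasure_eq_measure ennreal_mult' del: of_nat_Suc)
    also have "real (Suc q) * t ^ q * prob {\<omega> \<in> space M. t \<le> rescaled i \<omega>}
        = (\<Sum>s<i. real (Suc q) * real (N choose s) * (t ^ (s + q) * (1 - t) ^ (N - s)))"
      using True by (simp add: prob_le_rescaled[OF i] sum_distrib_left power_add mult_ac)
    also have "ennreal \<dots> = (\<Sum>s<i. ennreal (real (Suc q) * real (N choose s)) *
        ennreal (t ^ (s + q) * (1 - t) ^ (N - s)))"
      using True by (subst sum_ennreal[symmetric]) (auto simp: ennreal_mult' simp del: of_nat_Suc)
    finally show ?thesis using True by simp
  qed simp
  have "(\<integral>\<^sup>+\<omega>. ennreal (rescaled i \<omega> ^ Suc q) \<partial>M) = (\<integral>\<^sup>+\<omega>. \<integral>\<^sup>+t. ?g \<omega> t \<partial>lborel \<partial>M)"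
    by (rule nn_integral_cong_AE[OF layer])
  also have "\<dots> = (\<integral>\<^sup>+t. \<integral>\<^sup>+\<omega>. ?g \<omega> t \<partial>M \<partial>lborel)"
    by (rule Fubini'[symmetric]) measurable
  also have "\<dots> = (\<Sum>s<i. ennreal (real (Suc q) * real (N choose s)) *
      ennreal (fact (s + q) * fact (N - s) / fact (s + q + (N - s) + 1)))"
    unfolding prob
  proof (subst nn_integral_sum, measurable, intro sum.cong refl)
    fix s
    show "(\<integral>\<^sup>+t. ennreal (real (Suc q) * real (N choose s)) *
        (ennreal (t ^ (s + q) * (1 - t) ^ (N - s)) * indicator {0..1} t) \<partial>lborel)
      = ennreal (real (Suc q) * real (N choose s)) *
        ennreal (fact (s + q) * fact (N - s) / fact (s + q + (N - s) + 1))"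
      by (subst nn_integral_cmult, measurable, simp only: nn_integral_Beta_nat)
  qed
  also have "\<dots> = ennreal (\<Sum>s<i. real (Suc q) * real (N choose s) *
      (fact (s + q) * fact (N - s) / fact (s + q + (N - s) + 1)))"
    by (subst sum_ennreal[symmetric], simp, intro sum.cong refl ennreal_mult[symmetric]) simp_all
  \<comment> \<open>Here \<open>s < i \<le> N\<close>, so the truncated difference is genuine and
    \<open>s + q + (N - s) = N + q\<close>.\<close>
  also have "(\<Sum>s<i. real (Suc q) * real (N choose s) *
      (fact (s + q) * fact (N - s) / fact (s + q + (N - s) + 1)))
    = (\<Sum>s<i. real (Suc q) * real (N choose s) * (fact (s + q) * fact (N - s) / fact (N + q + 1)))"
    using i by (intro sum.cong) (auto simp: add_ac)
  also have "\<dots> = pochhammer (real i) (Suc q) / pochhammer (real N + 1) (Suc q)"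
    using i by (intro sum_binomial_beta) auto
  finally show ?thesis .
qed

lemma expectation_rescaled_power:
  assumes i: "i \<in> {1..N}"
  shows "expectation (\<lambda>\<omega>. rescaled i \<omega> ^ q) = pochhammer (real i) q / pochhammer (real N + 1) q"
\<comment> \<open>The layer-cake formula covers positive exponents only; for exponent 0 both sides
  are 1.\<close>
proof (cases q)
  case (Suc m)
  have "AE \<omega> in M. 0 \<le> rescaled i \<omega> ^ q"
    using AE_rescaled_in[OF i] by eventually_elim simp
  then have "ennreal (expectation (\<lambda>\<omega>. rescaled i \<omega> ^ q)) = (\<integral>\<^sup>+\<omega>. ennreal (rescaled i \<omega> ^ q) \<partial>M)"
    by (intro nn_integral_eq_integral[symmetric] integrable_rescaled_power[OF i])
  moreover have "0 \<le> expectation (\<lambda>\<omega>. rescaled i \<omega> ^ q)"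
    using \<open>AE \<omega> in M. 0 \<le> rescaled i \<omega> ^ q\<close> by (rule integral_nonneg_AE)
  ultimately show ?thesis
    using nn_integral_rescaled_power[OF i, of m] i
    by (simp add: Suc pochhammer_nonneg)
qed (simp add: prob_space)

text \<open>Undoing the affine rescaling and expanding binomially makes every moment on
  \<open>{a..b}\<close> a finite combination of the explicit moments of
  \<open>rescaled i\<close>.\<close>

lemma ordered_power_eq:
  "ordered i \<omega> ^ n = (\<Sum>q\<le>n. real (n choose q) * (b - a) ^ q * a ^ (n - q) * rescaled i \<omega> ^ q)"
proof -
  have "ordered i \<omega> = (b - a) * rescaled i \<omega> + a"
    using a_less_b by (simp add: rescaled_def)
  then show ?thesis by (simp add: binomial_ring power_mult_distrib mult_ac)
qed

lemma integrable_ordered_power: "i \<in> {1..N} \<Longrightarrow> integrable M (\<lambda>\<omega>. ordered i \<omega> ^ n)"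
  unfolding ordered_power_eq
  by (intro Bochner_Integration.integrable_sum integrable_mult_right integrable_rescaled_power)

lemma expectation_ordered_power:
  assumes "i \<in> {1..N}"
  shows "expectation (\<lambda>\<omega>. ordered i \<omega> ^ n) =
    (\<Sum>q\<le>n. real (n choose q) * (b - a) ^ q * a ^ (n - q) *
      (pochhammer (real i) q / pochhammer (real N + 1) q))"
  unfolding ordered_power_eq using assms
  by (subst Bochner_Integration.integral_sum)
    (simp_all add: integrable_rescaled_power expectation_rescaled_power)

lemma AE_ordered_nonneg:
  assumes "0 \<le> a"
  shows "AE \<omega> in M. \<forall>i\<in>{1..N}. 0 \<le> ordered i \<omega>"
  using AE_ordered_in
proof eventually_elim
  case (elim \<omega>)
  show ?case
  proof
    fix i assume "i \<in> {1..N}"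
    with elim have "ordered i \<omega> \<in> {a..b}" by blast
    with assms show "0 \<le> ordered i \<omega>" by simp
  qed
qed

lemma integrable_prod_ordered_power:
  assumes "0 \<le> a" and J: "finite J" "J \<subseteq> {1..N}"
  shows "integrable M (\<lambda>\<omega>. \<Prod>j\<in>J. ordered j \<omega> ^ p j)"
proof (rule integrable_const_bound[where B = "\<Prod>j\<in>J. b ^ p j"])
  show "AE \<omega> in M. norm (\<Prod>j\<in>J. ordered j \<omega> ^ p j) \<le> (\<Prod>j\<in>J. b ^ p j)"
    using AE_ordered_in
  proof eventually_elim
    case (elim \<omega>)
    have "0 \<le> ordered j \<omega>" "ordered j \<omega> \<le> b" if "j \<in> J" for j
      using bspec[OF elim, of j] that J(2) assms(1) by auto
    then show ?case by (auto simp: abs_prod power_abs intro!: prod_mono power_mono)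
  qed
  have "ordered j \<in> borel_measurable M" if "j \<in> J" for j
    using integrable_ordered_power[of j 1] that J(2) by auto
  then show "(\<lambda>\<omega>. \<Prod>j\<in>J. ordered j \<omega> ^ p j) \<in> borel_measurable M"
    by measurable
qed

text \<open>Replacing all factors by the smallest, or by the largest, keeps the total exponent
  \<open>P\<close>. The product of dependent variables is thus controlled by moments of single order
  statistics, without their joint law. Nonnegativity makes powers and products monotone.\<close>

lemma expectation_prod_ordered_bounds:
  fixes p :: "nat \<Rightarrow> nat"
  assumes a: "0 \<le> a" and "1 \<le> k" "m + k \<le> N"
  defines "P \<equiv> \<Sum>j=1..k. p j"
  shows "expectation (\<lambda>\<omega>. ordered (m + 1) \<omega> ^ P) \<le> expectation (\<lambda>\<omega>. \<Prod>j=1..k. ordered (m + j) \<omega> ^ p j)"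
    and "expectation (\<lambda>\<omega>. \<Prod>j=1..k. ordered (m + j) \<omega> ^ p j) \<le> expectation (\<lambda>\<omega>. ordered (m + k) \<omega> ^ P)"
proof -
  have P: "ordered i \<omega> ^ P = (\<Prod>j=1..k. ordered i \<omega> ^ p j)" for i \<omega>
    by (simp add: P_def power_sum)
  have mono: "ordered i \<omega> \<le> ordered j \<omega>" if "1 \<le> i" "i \<le> j" "j \<le> N" for i j \<omega>
    unfolding ordered_def using that by (rule order_statistic_mono)
  note nonneg = AE_ordered_nonneg[OF a]
  \<comment> \<open>Reindexing by \<open>j \<mapsto> m + j\<close> turns this into a product over a
    set of sites, the form covered by \<open>integrable_prod_ordered_power\<close>.\<close>
  have "(\<Prod>j=1..k. ordered (m + j) \<omega> ^ p j) = (\<Prod>j\<in>(+) m ` {1..k}. ordered j \<omega> ^ p (j - m))" for \<omega>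
    by (subst prod.reindex) auto
  moreover have "integrable M (\<lambda>\<omega>. \<Prod>j\<in>(+) m ` {1..k}. ordered j \<omega> ^ p (j - m))"
    using assms by (intro integrable_prod_ordered_power) auto
  ultimately have int: "integrable M (\<lambda>\<omega>. \<Prod>j=1..k. ordered (m + j) \<omega> ^ p j)"
    by simp
  show "expectation (\<lambda>\<omega>. ordered (m + 1) \<omega> ^ P) \<le> expectation (\<lambda>\<omega>. \<Prod>j=1..k. ordered (m + j) \<omega> ^ p j)"
  proof (intro integral_mono_AE int integrable_ordered_power)
    show "AE \<omega> in M. ordered (m + 1) \<omega> ^ P \<le> (\<Prod>j=1..k. ordered (m + j) \<omega> ^ p j)"
      using nonneg unfolding P
      by eventually_elim (use assms in \<open>auto intro!: prod_mono power_mono mono\<close>)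
  qed (use assms in auto)
  show "expectation (\<lambda>\<omega>. \<Prod>j=1..k. ordered (m + j) \<omega> ^ p j) \<le> expectation (\<lambda>\<omega>. ordered (m + k) \<omega> ^ P)"
  proof (intro integral_mono_AE int integrable_ordered_power)
    show "AE \<omega> in M. (\<Prod>j=1..k. ordered (m + j) \<omega> ^ p j) \<le> ordered (m + k) \<omega> ^ P"
      using nonneg unfolding P
      by eventually_elim (use assms in \<open>auto intro!: prod_mono power_mono mono\<close>)
  qed (use assms in auto)
qed

end

section \<open>Expectation of the duality polynomial\<close>

text \<open>Given \<Theta>, the sites are independent, so the conditional expectation factorizes
  into geometric factorial moments, one per site.\<close>

lemma expectation_duality_poly:
  assumes "prob_space M"
    and law: "has_conditional_law M
      (Pi\<^sub>M {1..N} (\<lambda>_. borel)) (\<lambda>\<omega>. \<lambda>i\<in>{1..N}. \<Theta> i \<omega>)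
      (Pi\<^sub>M {1..N} (\<lambda>_. count_space UNIV)) (\<lambda>\<omega>. \<lambda>i\<in>{1..N}. \<eta> i \<omega>)
      (\<lambda>\<theta>. Pi\<^sub>M {1..N} (\<lambda>i. measure_pmf (geom_mean (\<theta> i))))"
    and nonneg: "AE \<omega> in M. \<forall>i\<in>{1..N}. 0 \<le> \<Theta> i \<omega>"
  shows "(\<integral>\<omega>. duality_poly N (\<lambda>i. \<eta> i \<omega>) \<xi> \<partial>M) = (\<integral>\<omega>. (\<Prod>i=1..N. \<Theta> i \<omega> ^ \<xi> i) \<partial>M)"
proof -
  interpret prob_space M by fact
  have T: "(\<lambda>\<omega>. \<lambda>i\<in>{1..N}. \<Theta> i \<omega>) \<in> measurable M (Pi\<^sub>M {1..N} (\<lambda>_. borel))"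
    and X: "(\<lambda>\<omega>. \<lambda>i\<in>{1..N}. \<eta> i \<omega>) \<in> measurable M (Pi\<^sub>M {1..N} (\<lambda>_. count_space UNIV))"
    using law by (auto simp: has_conditional_law_def)
  have [measurable]: "\<Theta> i \<in> borel_measurable M" if "i \<in> {1..N}" for i
    using measurable_compose[OF T measurable_component_singleton[OF that]] that by simp
  have [measurable]: "\<eta> i \<in> measurable M (count_space UNIV)" if "i \<in> {1..N}" for i
    using measurable_compose[OF X measurable_component_singleton[OF that]] that by simp
  have D: "duality_poly N y \<xi> = (\<Prod>i=1..N. real (y i choose \<xi> i))" for y
    unfolding duality_poly_def by (intro prod.cong) (auto simp: binomial_eq_0 not_le)
  have inner: "(\<integral>\<^sup>+y. (\<Prod>i=1..N. ennreal (real (y i choose \<xi> i))) \<partial>Pi\<^sub>M {1..N} (\<lambda>i. measure_pmf (geom_mean (\<theta> i))))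
      = ennreal (\<Prod>i=1..N. \<theta> i ^ \<xi> i)" if "\<And>i. i \<in> {1..N} \<Longrightarrow> 0 \<le> \<theta> i" for \<theta>
  proof -
    interpret product_sigma_finite "\<lambda>i. measure_pmf (geom_mean (\<theta> i))"
      by (intro product_sigma_finite.intro measure_pmf.sigma_finite_measure_axioms)
    have "(\<integral>\<^sup>+y. (\<Prod>i=1..N. ennreal (real (y i choose \<xi> i))) \<partial>Pi\<^sub>M {1..N} (\<lambda>i. measure_pmf (geom_mean (\<theta> i))))
        = (\<Prod>i=1..N. ennreal (\<theta> i ^ \<xi> i))"
      using that by (subst product_nn_integral_prod) (auto simp: nn_integral_binomial_geom_mean)
    also have "\<dots> = ennreal (\<Prod>i=1..N. \<theta> i ^ \<xi> i)"
      by (rule prod_ennreal) (use that in auto)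
    finally show ?thesis .
  qed
  have "(\<integral>\<^sup>+\<omega>. ennreal (duality_poly N (\<lambda>i. \<eta> i \<omega>) \<xi>) \<partial>M)
      = (\<integral>\<^sup>+\<omega>. (\<Prod>i=1..N. ennreal (real ((\<lambda>i\<in>{1..N}. \<eta> i \<omega>) i choose \<xi> i))) \<partial>M)"
    by (simp add: D prod_ennreal)
  also have "\<dots> = (\<integral>\<^sup>+\<omega>. (\<integral>\<^sup>+y. (\<Prod>i=1..N. ennreal (real (y i choose \<xi> i)))
      \<partial>Pi\<^sub>M {1..N} (\<lambda>i. measure_pmf (geom_mean ((\<lambda>i\<in>{1..N}. \<Theta> i \<omega>) i)))) \<partial>M)"
  proof (rule nn_integral_conditional_law[OF \<open>prob_space M\<close> law])
    show "prob_space (Pi\<^sub>M {1..N} (\<lambda>i. measure_pmf (geom_mean (t i))))" for t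
      by (intro prob_space_PiM measure_pmf.prob_space_axioms)
    show "sets (Pi\<^sub>M {1..N} (\<lambda>i. measure_pmf (geom_mean (t i)))) = sets (Pi\<^sub>M {1..N} (\<lambda>_. count_space UNIV))" for t
      by (intro sets_PiM_cong) auto
  qed measurable
  \<comment> \<open>Nonnegativity of \<Theta> is assumed only almost surely, so \<open>inner\<close>
    is applied off a null set.\<close>
  also have "\<dots> = (\<integral>\<^sup>+\<omega>. ennreal (\<Prod>i=1..N. \<Theta> i \<omega> ^ \<xi> i) \<partial>M)"
    using nonneg by (intro nn_integral_cong_AE, eventually_elim, subst inner) auto
  finally have eq: "(\<integral>\<^sup>+\<omega>. ennreal (duality_poly N (\<lambda>i. \<eta> i \<omega>) \<xi>) \<partial>M)
      = (\<integral>\<^sup>+\<omega>. ennreal (\<Prod>i=1..N. \<Theta> i \<omega> ^ \<xi> i) \<partial>M)" .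
  \<comment> \<open>Both integrands are measurable and almost surely nonnegative, so each Bochner
    integral is \<open>enn2real\<close> of the nonnegative integral, and finiteness never has to be
    proved.\<close>
  have "(\<integral>\<omega>. duality_poly N (\<lambda>i. \<eta> i \<omega>) \<xi> \<partial>M)
      = enn2real (\<integral>\<^sup>+\<omega>. ennreal (duality_poly N (\<lambda>i. \<eta> i \<omega>) \<xi>) \<partial>M)"
    unfolding D by (intro integral_eq_nn_integral) (auto intro!: prod_nonneg)
  also have "\<dots> = (\<integral>\<omega>. (\<Prod>i=1..N. \<Theta> i \<omega> ^ \<xi> i) \<partial>M)"
    unfolding eq
  proof (intro integral_eq_nn_integral[symmetric])
    show "AE \<omega> in M. 0 \<le> (\<Prod>i=1..N. \<Theta> i \<omega> ^ \<xi> i)"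
      using nonneg by eventually_elim (auto intro!: prod_nonneg)
  qed measurable
  finally show ?thesis .
qed

text \<open>The sum in the exponent becomes a product over \<open>j\<close>. After exchanging the
  products, each \<open>j\<close> contributes only at site \<open>m + j\<close>, which lies in
  \<open>{1..N}\<close> because \<open>m + k \<le> N\<close>.\<close>

lemma prod_power_single_particle:
  fixes t :: "nat \<Rightarrow> 'a :: comm_semiring_1"
  assumes "m + k \<le> N"
  shows "(\<Prod>i=1..N. t i ^ (\<Sum>j=1..k. p j * single_particle (m + j) i)) = (\<Prod>j=1..k. t (m + j) ^ p j)"
proof -
  have "(\<Prod>i=1..N. t i ^ (\<Sum>j=1..k. p j * single_particle (m + j) i))
      = (\<Prod>j=1..k. \<Prod>i=1..N. t i ^ (p j * single_particle (m + j) i))"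
    by (simp only: power_sum) (rule prod.swap)
  also have "\<dots> = (\<Prod>j=1..k. t (m + j) ^ p j)"
  proof (intro prod.cong refl)
    fix j assume j: "j \<in> {1..k}"
    have "(\<Prod>i=1..N. t i ^ (p j * single_particle (m + j) i)) = (\<Prod>i=1..N. if i = m + j then t i ^ p j else 1)"
      by (intro prod.cong) (auto simp: single_particle_def)
    then show "(\<Prod>i=1..N. t i ^ (p j * single_particle (m + j) i)) = t (m + j) ^ p j"
      using j assms by simp
  qed
  finally show ?thesis .
qed

section \<open>Asymptotics of the moments\<close>

lemma bigo_cmult:
  fixes f g :: "'a \<Rightarrow> real"
  shows "f \<in> O[F](g) \<Longrightarrow> (\<lambda>x. c * f x) \<in> O[F](g)"
  by (cases "c = 0") auto

text \<open>The ratio is a product of \<open>q\<close> factors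
  \<open>(r N + l) / (N + 1 + l)\<close>, each equal to \<open>x + O(1/N)\<close>. The induction
  multiplies in one factor at a time.\<close>

lemma pochhammer_ratio_asymp:
  fixes r :: "nat \<Rightarrow> real"
  assumes r: "(\<lambda>N. r N - x * real N) \<in> O(\<lambda>_. 1)"
  shows "(\<lambda>N. pochhammer (r N) q / pochhammer (real N + 1) q - x ^ q) \<in> O(\<lambda>N. 1 / real N)"
proof (induction q)
  case (Suc q)
  let ?f = "\<lambda>N. pochhammer (r N) q / pochhammer (real N + 1) q"
  let ?h = "\<lambda>N. (r N + real q) / (real N + 1 + real q)"
  have h: "(\<lambda>N. ?h N - x) \<in> O(\<lambda>N. 1 / real N)"
  proof -
    have "(\<lambda>N. ((r N - x * real N) + (real q - x * (1 + real q))) * (1 / (real N + 1 + real q)))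
        \<in> O(\<lambda>N. 1 * (1 / real N))"
    proof (intro landau_o.big.mult sum_in_bigo(1)[OF r])
      show "(\<lambda>N. 1 / (real N + 1 + real q)) \<in> O(\<lambda>N. 1 / real N)"
        by (intro bigoI[of _ 1] eventually_mono[OF eventually_gt_at_top[of 0]]) (auto simp: field_simps)
    qed auto
    moreover have "?h N - x = ((r N - x * real N) + (real q - x * (1 + real q))) * (1 / (real N + 1 + real q))" for N
      by (simp add: field_simps)
    ultimately show ?thesis by simp
  qed
  \<comment> \<open>In the product of the two errors, one is weakened to \<open>O(1)\<close>, which
    keeps that product at order \<open>1 / N\<close>.\<close>
  have bounded: "(\<lambda>N. 1 / real N) \<in> O(\<lambda>_. 1)"
    by (intro bigoI[of _ 1]) (auto simp: eventually_at_top_linorder intro!: exI[of _ 1])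
  have "(\<lambda>N. (?f N - x ^ q) * (?h N - x)) \<in> O(\<lambda>N. 1 / real N * 1)"
    by (intro landau_o.big.mult Suc landau_o.big_trans[OF h bounded])
  moreover have "(\<lambda>N. (?f N - x ^ q) * x) \<in> O(\<lambda>N. 1 / real N)"
    using bigo_cmult[OF Suc, of x] by (simp add: mult.commute)
  moreover have "(\<lambda>N. x ^ q * (?h N - x)) \<in> O(\<lambda>N. 1 / real N)"
    by (rule bigo_cmult[OF h])
  \<comment> \<open>This is the expansion \<open>A * B - a * b = (A - a) * (B - b) + (A - a) * b + a
    * (B - b)\<close>, with \<open>A\<close>, \<open>B\<close> the values of \<open>?f\<close>,
    \<open>?h\<close> and \<open>a\<close>, \<open>b\<close> their limits.\<close>
  ultimately have "(\<lambda>N. (?f N - x ^ q) * (?h N - x) + (?f N - x ^ q) * x + x ^ q * (?h N - x))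
      \<in> O(\<lambda>N. 1 / real N)"
    by (intro sum_in_bigo) auto
  moreover have "(?f N - x ^ q) * (?h N - x) + (?f N - x ^ q) * x + x ^ q * (?h N - x)
      = pochhammer (r N) (Suc q) / pochhammer (real N + 1) (Suc q) - x ^ Suc q" for N
    by (simp add: pochhammer_Suc algebra_simps)
  ultimately show ?case by simp
qed simp

section \<open>Squeezing the expectation\<close>

theorem theorem4p2:
  fixes M :: "nat \<Rightarrow> 'a measure"
    and U \<Theta> :: "nat \<Rightarrow> nat \<Rightarrow> 'a \<Rightarrow> real"
    and \<eta> :: "nat \<Rightarrow> nat \<Rightarrow> 'a \<Rightarrow> nat"
    and \<theta>L \<theta>R x :: real
    and k :: nat
    and p :: "nat \<Rightarrow> nat"
  assumes "0 \<le> \<theta>L" and "\<theta>L < \<theta>R"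
    and "\<And>N. N \<ge> 1 \<Longrightarrow> prob_space (M N)"
    and "\<And>N. N \<ge> 1 \<Longrightarrow> prob_space.indep_vars (M N) (\<lambda>_. borel) (U N) {1..N}"
    and "\<And>N i. N \<ge> 1 \<Longrightarrow> i \<in> {1..N} \<Longrightarrow>
           distr (M N) borel (U N i) = uniform_measure lborel {\<theta>L..\<theta>R}"
    and "\<And>N i \<omega>. N \<ge> 1 \<Longrightarrow> i \<in> {1..N} \<Longrightarrow> \<omega> \<in> space (M N) \<Longrightarrow>
           \<Theta> N i \<omega> = order_statistic N (\<lambda>j. U N j \<omega>) i"
    and "\<And>N. N \<ge> 1 \<Longrightarrow>
           has_conditional_law (M N)
             (Pi\<^sub>M {1..N} (\<lambda>_. borel)) (\<lambda>\<omega>. \<lambda>i\<in>{1..N}. \<Theta> N i \<omega>)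
             (Pi\<^sub>M {1..N} (\<lambda>_. count_space UNIV)) (\<lambda>\<omega>. \<lambda>i\<in>{1..N}. \<eta> N i \<omega>)
             (\<lambda>\<theta>. Pi\<^sub>M {1..N} (\<lambda>i. measure_pmf (geom_mean (\<theta> i))))"
    and "k \<ge> 1" and "0 < x" and "x < 1"
  shows "(\<lambda>N. prob_space.expectation (M N)
             (\<lambda>\<omega>. duality_poly N (\<lambda>i. \<eta> N i \<omega>)
                    (\<lambda>i. \<Sum>j = 1..k. p j * single_particle (nat \<lfloor>x * real N\<rfloor> + j) i))
           - linear_profile \<theta>L \<theta>R x ^ (\<Sum>j = 1..k. p j))
         \<in> O(\<lambda>N. 1 / real N)"
proof -
  define m where "m N = nat \<lfloor>x * real N\<rfloor>" for N
  define P where "P = (\<Sum>j = 1..k. p j)"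
  \<comment> \<open>When \<open>m N + i\<close> is a site, this is the exact \<open>P\<close>-th
    moment of the order statistic there. As a closed formula it makes sense for every
    \<open>N\<close>, so its asymptotics can be studied without a range condition.\<close>
  define \<mu> where "\<mu> i N = (\<Sum>q\<le>P. real (P choose q) * (\<theta>R - \<theta>L) ^ q * \<theta>L ^ (P - q) *
      (pochhammer (real (m N + i)) q / pochhammer (real N + 1) q))" for i N
  let ?\<rho> = "linear_profile \<theta>L \<theta>R x"
  let ?E = "\<lambda>N. prob_space.expectation (M N)
             (\<lambda>\<omega>. duality_poly N (\<lambda>i. \<eta> N i \<omega>)
                    (\<lambda>i. \<Sum>j = 1..k. p j * single_particle (m N + j) i))"
  have \<mu>: "(\<lambda>N. \<mu> i N - ?\<rho> ^ P) \<in> O(\<lambda>N. 1 / real N)" for i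
  proof -
    \<comment> \<open>The floor costs at most 1 and the shift costs \<open>i\<close>.\<close>
    have "\<bar>real (m N + i) - x * real N\<bar> \<le> real i + 1" for N
      using \<open>0 < x\<close> unfolding m_def by (simp add: of_nat_nat) linarith
    then have "(\<lambda>N. real (m N + i) - x * real N) \<in> O(\<lambda>_. 1)"
      by (intro bigoI[of _ "real i + 1"]) auto
    note pochhammer_ratio_asymp[OF this]
    then have "(\<lambda>N. \<Sum>q\<le>P. real (P choose q) * (\<theta>R - \<theta>L) ^ q * \<theta>L ^ (P - q) *
        (pochhammer (real (m N + i)) q / pochhammer (real N + 1) q - x ^ q)) \<in> O(\<lambda>N. 1 / real N)"
      by (intro big_sum_in_bigo bigo_cmult)
    moreover have "?\<rho> ^ P = (\<Sum>q\<le>P. real (P choose q) * (\<theta>R - \<theta>L) ^ q * \<theta>L ^ (P - q) * x ^ q)"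
      unfolding linear_profile_def by (subst add.commute) (simp add: binomial_ring power_mult_distrib mult_ac)
    ultimately show ?thesis
      by (simp add: \<mu>_def sum_subtractf right_diff_distrib)
  qed
  have bounds: "\<mu> 1 N \<le> ?E N \<and> ?E N \<le> \<mu> k N" if N: "N \<ge> 1" "m N + k \<le> N" for N
  proof -
    interpret prob_space "M N" using N assms(3) by blast
    interpret uniform_sample "M N" "U N" N \<theta>L \<theta>R
      by (intro uniform_sample.intro uniform_sample_axioms.intro prob_space_axioms assms N)
    have \<Theta>: "\<Theta> N i \<omega> = ordered i \<omega>" if "i \<in> {1..N}" "\<omega> \<in> space (M N)" for i \<omega>
      using assms(6)[OF N(1) that] by (simp add: ordered_def)
    have "AE \<omega> in M N. \<forall>i\<in>{1..N}. 0 \<le> \<Theta> N i \<omega>"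
      using AE_ordered_nonneg[OF \<open>0 \<le> \<theta>L\<close>] AE_space by eventually_elim (simp add: \<Theta>)
    then have "?E N = expectation (\<lambda>\<omega>. \<Prod>i=1..N. \<Theta> N i \<omega> ^ (\<Sum>j = 1..k. p j * single_particle (m N + j) i))"
      by (intro expectation_duality_poly assms N)
    also have "\<dots> = expectation (\<lambda>\<omega>. \<Prod>j=1..k. \<Theta> N (m N + j) \<omega> ^ p j)"
      by (simp only: prod_power_single_particle[OF N(2), where t = "\<lambda>i. \<Theta> N i \<omega>" for \<omega>])
    also have "\<dots> = expectation (\<lambda>\<omega>. \<Prod>j=1..k. ordered (m N + j) \<omega> ^ p j)"
      using N by (intro Bochner_Integration.integral_cong prod.cong refl) (simp add: \<Theta>)
    finally show ?thesis
      using expectation_prod_ordered_bounds[OF \<open>0 \<le> \<theta>L\<close> \<open>k \<ge> 1\<close> N(2), of p]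
        expectation_ordered_power[of "m N + 1" P] expectation_ordered_power[of "m N + k" P] N \<open>k \<ge> 1\<close>
      by (simp add: \<mu>_def P_def)
  qed
  have "\<forall>\<^sub>F N in sequentially. N \<ge> 1 \<and> m N + k \<le> N"
  proof -
    \<comment> \<open>The threshold comes from \<open>m N \<le> x * N\<close>: the sites fit as soon
      as \<open>k \<le> (1 - x) * N\<close>.\<close>
    have "\<forall>\<^sub>F N in sequentially. real N \<ge> real k / (1 - x)"
      using filterlim_real_sequentially by (simp add: filterlim_at_top)
    with eventually_ge_at_top[of 1] show ?thesis
    proof eventually_elim
      case (elim N)
      have "real (m N) \<le> x * real N"
        using \<open>0 < x\<close> unfolding m_def by simp
      moreover have "real k \<le> (1 - x) * real N"
        using elim \<open>x < 1\<close> by (simp add: field_simps)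
      ultimately have "real (m N + k) \<le> real N" by (simp add: algebra_simps)
      then show ?case using elim by simp
    qed
  qed
  \<comment> \<open>A number between \<open>\<mu> 1 N\<close> and \<open>\<mu> k N\<close> is no
    farther from the limit than the sum of their two distances to it.\<close>
  then have "\<forall>\<^sub>F N in sequentially.
      norm (?E N - ?\<rho> ^ P) \<le> norm (\<bar>\<mu> 1 N - ?\<rho> ^ P\<bar> + \<bar>\<mu> k N - ?\<rho> ^ P\<bar>)"
    by eventually_elim (use bounds in force)
  moreover have "(\<lambda>N. \<bar>\<mu> 1 N - ?\<rho> ^ P\<bar> + \<bar>\<mu> k N - ?\<rho> ^ P\<bar>) \<in> O(\<lambda>N. 1 / real N)"
    by (intro sum_in_bigo) (simp_all add: \<mu>)
  ultimately have "(\<lambda>N. ?E N - ?\<rho> ^ P) \<in> O(\<lambda>N. 1 / real N)"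
    by (rule landau_o.big_trans[OF landau_o.big_mono])
  then show ?thesis by (simp only: m_def P_def)
qed

end
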